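(* If $X$ is a real Banach space with property (dc) (respectively, (Cdc)), then for any closed subspace $E$ of $X$ the quotient $X/E$ has property (dc) (respectively, (Cdc)).
   Context: A function $q\colon X\to\mathbb{R}$ is a continuous quadratic form if there is a continuous bilinear form $b\colon X\times X\to\mathbb{R}$ with $q(x)=b(x,x)$ for all $x$. A function on $X$ is delta-convex if it is the difference of two continuous convex functions on $X$. A function $f\colon X\to\mathbb{R}$ is $C^{1,1}$ if its Fr\'echet derivative $f'(x)$ exists at each $x\in X$ and the mapping $f'\colon X\to X^*$ is Lipschitz. Property (dc) of $X$: each continuous quadratic form on $X$ is delta-convex. Property (Cdc) of $X$: each $C^{1,1}$ function $f\colon X\to\mathbb{R}$ is delta-convex. *)

theory Defs
  imports "HOL-Analysis.Analysis"
begin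

text \<open>
  The quotient of a space by a subspace depends on a term and hence is not a type.  Normed spaces
  are therefore records with an explicit carrier; the type-class space \<open>'a\<close> is the
  record \<open>whole_space\<close>.  Functions on a space are only relevant on its carrier.
\<close>

record 'v nspace =
  carr :: "'v set"
  vadd :: "'v \<Rightarrow> 'v \<Rightarrow> 'v"
  vzero :: "'v"
  vscale :: "real \<Rightarrow> 'v \<Rightarrow> 'v"
  vnorm :: "'v \<Rightarrow> real"

locale normed_space_on =
  fixes V :: "'v nspace"
  assumes zero_closed: "vzero V \<in> carr V"
    and add_closed: "\<lbrakk>x \<in> carr V; y \<in> carr V\<rbrakk> \<Longrightarrow> vadd V x y \<in> carr V"
    and scale_closed: "x \<in> carr V \<Longrightarrow> vscale V c x \<in> carr V"
    and add_assoc: "\<lbrakk>x \<in> carr V; y \<in> carr V; z \<in> carr V\<rbrakk>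
      \<Longrightarrow> vadd V (vadd V x y) z = vadd V x (vadd V y z)"
    and add_commute: "\<lbrakk>x \<in> carr V; y \<in> carr V\<rbrakk> \<Longrightarrow> vadd V x y = vadd V y x"
    and add_zero: "x \<in> carr V \<Longrightarrow> vadd V (vzero V) x = x"
    and add_inverse: "x \<in> carr V \<Longrightarrow> vadd V x (vscale V (-1) x) = vzero V"
    and scale_add_right: "\<lbrakk>x \<in> carr V; y \<in> carr V\<rbrakk>
      \<Longrightarrow> vscale V c (vadd V x y) = vadd V (vscale V c x) (vscale V c y)"
    and scale_add_left: "x \<in> carr V
      \<Longrightarrow> vscale V (c + d) x = vadd V (vscale V c x) (vscale V d x)"
    and scale_scale: "x \<in> carr V \<Longrightarrow> vscale V c (vscale V d x) = vscale V (c * d) x"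
    and scale_one: "x \<in> carr V \<Longrightarrow> vscale V 1 x = x"
    and norm_nonneg: "x \<in> carr V \<Longrightarrow> 0 \<le> vnorm V x"
    and norm_eq_zero: "x \<in> carr V \<Longrightarrow> vnorm V x = 0 \<longleftrightarrow> x = vzero V"
    and norm_triangle: "\<lbrakk>x \<in> carr V; y \<in> carr V\<rbrakk>
      \<Longrightarrow> vnorm V (vadd V x y) \<le> vnorm V x + vnorm V y"
    and norm_scale: "x \<in> carr V \<Longrightarrow> vnorm V (vscale V c x) = \<bar>c\<bar> * vnorm V x"

definition whole_space :: "'a::real_normed_vector nspace" where
  "whole_space = \<lparr>carr = UNIV, vadd = (+), vzero = 0, vscale = (*\<^sub>R), vnorm = norm\<rparr>"

text \<open>
  The points of \<open>X/E\<close> are the cosets \<open>x + E\<close>, with the infimum norm.  The summand \<open>+ E\<close> in the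
  scalar multiple matters only for \<open>c = 0\<close>, where the image alone would be \<open>{0}\<close>.
\<close>

definition quotient_space :: "'a::real_normed_vector set \<Rightarrow> 'a set nspace" where
  "quotient_space E =
    \<lparr>carr = range (\<lambda>x. x +o E),
     vadd = (\<lambda>A B. A + B),
     vzero = E,
     vscale = (\<lambda>c A. (*\<^sub>R) c ` A + E),
     vnorm = (\<lambda>A. INF a\<in>A. norm a)\<rparr>"

text \<open>
  The locale \<^locale>\<open>Metric_space\<close> demands symmetry and nonnegativity of the distance also
  off the carrier, hence the value 0 there.
\<close>

definition vdist :: "'v nspace \<Rightarrow> 'v \<Rightarrow> 'v \<Rightarrow> real" where
  "vdist V x y =
    (if x \<in> carr V \<and> y \<in> carr V then vnorm V (vadd V x (vscale V (-1) y)) else 0)"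

definition vtopology :: "'v nspace \<Rightarrow> 'v topology" where
  "vtopology V = Metric_space.mtopology (carr V) (vdist V)"

definition continuous_fun :: "'v nspace \<Rightarrow> ('v \<Rightarrow> real) \<Rightarrow> bool" where
  "continuous_fun V f \<longleftrightarrow> continuous_map (vtopology V) euclideanreal f"

definition linear_functional :: "'v nspace \<Rightarrow> ('v \<Rightarrow> real) \<Rightarrow> bool" where
  "linear_functional V \<phi> \<longleftrightarrow>
    (\<forall>x\<in>carr V. \<forall>y\<in>carr V. \<phi> (vadd V x y) = \<phi> x + \<phi> y) \<and>
    (\<forall>c. \<forall>x\<in>carr V. \<phi> (vscale V c x) = c * \<phi> x)"

definition continuous_bilinear_form :: "'v nspace \<Rightarrow> ('v \<Rightarrow> 'v \<Rightarrow> real) \<Rightarrow> bool" where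
  "continuous_bilinear_form V b \<longleftrightarrow>
    (\<forall>x\<in>carr V. linear_functional V (\<lambda>y. b x y)) \<and>
    (\<forall>y\<in>carr V. linear_functional V (\<lambda>x. b x y)) \<and>
    continuous_map (prod_topology (vtopology V) (vtopology V)) euclideanreal (\<lambda>(x, y). b x y)"

definition continuous_quadratic_form :: "'v nspace \<Rightarrow> ('v \<Rightarrow> real) \<Rightarrow> bool" where
  "continuous_quadratic_form V q \<longleftrightarrow>
    (\<exists>b. continuous_bilinear_form V b \<and> (\<forall>x\<in>carr V. q x = b x x))"

definition convex_fun :: "'v nspace \<Rightarrow> ('v \<Rightarrow> real) \<Rightarrow> bool" where
  "convex_fun V f \<longleftrightarrow>
    (\<forall>t. \<forall>x\<in>carr V. \<forall>y\<in>carr V. 0 \<le> t \<and> t \<le> 1 \<longrightarrow>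
      f (vadd V (vscale V (1 - t) x) (vscale V t y)) \<le> (1 - t) * f x + t * f y)"

definition delta_convex :: "'v nspace \<Rightarrow> ('v \<Rightarrow> real) \<Rightarrow> bool" where
  "delta_convex V f \<longleftrightarrow>
    (\<exists>g h. continuous_fun V g \<and> convex_fun V g \<and> continuous_fun V h \<and> convex_fun V h \<and>
      (\<forall>x\<in>carr V. f x = g x - h x))"

text \<open>
  As in \<^const>\<open>onorm\<close>, the term for \<open>x = 0\<close> is \<open>0 / 0 = 0\<close>.
\<close>

definition dual_norm :: "'v nspace \<Rightarrow> ('v \<Rightarrow> real) \<Rightarrow> real" where
  "dual_norm V \<phi> = (SUP x\<in>carr V. \<bar>\<phi> x\<bar> / vnorm V x)"

definition has_frechet_derivative ::
    "'v nspace \<Rightarrow> ('v \<Rightarrow> real) \<Rightarrow> ('v \<Rightarrow> real) \<Rightarrow> 'v \<Rightarrow> bool" where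
  "has_frechet_derivative V f \<phi> x \<longleftrightarrow>
    linear_functional V \<phi> \<and> continuous_fun V \<phi> \<and>
    limitin euclideanreal (\<lambda>h. (f (vadd V x h) - f x - \<phi> h) / vnorm V h) 0
      (atin (vtopology V) (vzero V))"

definition C11_fun :: "'v nspace \<Rightarrow> ('v \<Rightarrow> real) \<Rightarrow> bool" where
  "C11_fun V f \<longleftrightarrow>
    (\<exists>f'. (\<forall>x\<in>carr V. has_frechet_derivative V f (f' x) x) \<and>
      (\<exists>L. \<forall>x\<in>carr V. \<forall>y\<in>carr V. dual_norm V (\<lambda>h. f' x h - f' y h) \<le> L * vdist V x y))"

definition property_dc :: "'v nspace \<Rightarrow> bool" where
  "property_dc V \<longleftrightarrow> (\<forall>q. continuous_quadratic_form V q \<longrightarrow> delta_convex V q)"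

definition property_Cdc :: "'v nspace \<Rightarrow> bool" where
  "property_Cdc V \<longleftrightarrow> (\<forall>f. C11_fun V f \<longrightarrow> delta_convex V f)"


lemma (in normed_space_on) Metric_space_vdist: "Metric_space (carr V) (vdist V)"
proof -
  have neg_neg: "vscale V (-1) (vscale V (-1) x) = x" if "x \<in> carr V" for x
    using that by (simp add: scale_scale scale_one)
  have cl: "vadd V x (vscale V (-1) y) \<in> carr V" if "x \<in> carr V" "y \<in> carr V" for x y
    using that by (simp add: add_closed scale_closed)
  have neg_diff: "vscale V (-1) (vadd V x (vscale V (-1) y)) = vadd V y (vscale V (-1) x)"
    if "x \<in> carr V" "y \<in> carr V" for x y
    using that by (simp add: scale_add_right scale_closed neg_neg add_commute)
  have cancel: "vadd V (vadd V x (vscale V (-1) y)) y = x"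
    if "x \<in> carr V" "y \<in> carr V" for x y
    using that
    by (metis add_assoc add_commute add_inverse add_zero scale_closed zero_closed)
  show ?thesis
  proof
    fix x y
    show "0 \<le> vdist V x y"
      by (simp add: vdist_def norm_nonneg cl)
    show "vdist V x y = vdist V y x"
    proof (cases "x \<in> carr V \<and> y \<in> carr V")
      case True
      then have "vnorm V (vadd V y (vscale V (-1) x)) = vnorm V (vadd V x (vscale V (-1) y))"
        using norm_scale[OF cl, of x y "-1"] by (simp add: neg_diff)
      then show ?thesis by (simp add: vdist_def)
    qed (auto simp: vdist_def)
  next
    fix x y assume xy: "x \<in> carr V" "y \<in> carr V"
    have "vadd V x (vscale V (-1) y) = vzero V \<longleftrightarrow> x = y"
      using cancel[OF xy] add_inverse add_zero xy by metis
    then show "vdist V x y = 0 \<longleftrightarrow> x = y"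
      using xy by (simp add: vdist_def norm_eq_zero cl)
  next
    fix x y z assume xyz: "x \<in> carr V" "y \<in> carr V" "z \<in> carr V"
    have "vadd V (vadd V x (vscale V (-1) y)) (vadd V y (vscale V (-1) z))
        = vadd V x (vscale V (-1) z)"
      using xyz cancel[OF xyz(1,2)] by (metis add_assoc cl scale_closed)
    then show "vdist V x z \<le> vdist V x y + vdist V y z"
      using norm_triangle[OF cl[OF xyz(1,2)] cl[OF xyz(2,3)]] xyz by (simp add: vdist_def)
  qed
qed


text \<open>On a type-class space the notions above agree with those of the library.\<close>

lemma whole_space_simps [simp]:
  "carr whole_space = UNIV" "vadd whole_space = (+)" "vzero whole_space = 0"
  "vscale whole_space = (*\<^sub>R)" "vnorm whole_space = norm"
  by (simp_all add: whole_space_def)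

lemma normed_space_on_whole_space: "normed_space_on whole_space"
  by unfold_locales (simp_all add: algebra_simps norm_triangle_ineq)

lemma vdist_whole_space [simp]: "vdist whole_space = dist"
  by (simp add: vdist_def fun_eq_iff dist_norm)

lemma vtopology_whole_space [simp]: "vtopology whole_space = euclidean"
  by (simp add: vtopology_def)

lemma continuous_fun_whole_space: "continuous_fun whole_space f \<longleftrightarrow> continuous_on UNIV f"
  by (simp add: continuous_fun_def)

lemma linear_functional_whole_space: "linear_functional whole_space f \<longleftrightarrow> linear f"
  by (auto simp: linear_functional_def linear_iff)

lemma continuous_linear_functional_whole_space:
  "linear_functional whole_space f \<and> continuous_fun whole_space f \<longleftrightarrow> bounded_linear f"
proof
  assume "linear_functional whole_space f \<and> continuous_fun whole_space f"
  then have lin: "linear f" and "continuous_on UNIV f"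
    by (auto simp: continuous_fun_whole_space linear_functional_whole_space)
  then have "isCont f 0"
    by (simp add: continuous_on_eq_continuous_at)
  then obtain d where d: "d > 0" "\<And>x. norm x < d \<Longrightarrow> \<bar>f x\<bar> < 1"
    using linear_0[OF lin] unfolding continuous_at_eps_delta
    by (auto simp: dist_norm dest: spec[of _ 1])
  have "\<bar>f x\<bar> \<le> norm x * (2 / d)" for x
  proof (cases "x = 0")
    case False
    have "\<bar>f ((d / 2 / norm x) *\<^sub>R x)\<bar> < 1"
      using d(1) False by (intro d(2)) simp
    then show ?thesis
      using d(1) False by (simp add: linear_scale[OF lin] abs_mult field_simps)
  qed (simp add: linear_0[OF lin])
  then show "bounded_linear f"
    using lin by (auto intro!: bounded_linear_intro[where K="2/d"] simp: linear_add linear_scale)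
next
  assume "bounded_linear f"
  then show "linear_functional whole_space f \<and> continuous_fun whole_space f"
    by (simp add: continuous_fun_whole_space linear_functional_whole_space
        bounded_linear.linear linear_continuous_on)
qed

lemma continuous_bilinear_form_whole_space:
  fixes b :: "'a::real_normed_vector \<Rightarrow> 'a \<Rightarrow> real"
  shows "continuous_bilinear_form whole_space b \<longleftrightarrow> bounded_bilinear b"
proof
  assume b: "continuous_bilinear_form whole_space b"
  then have l1: "linear (\<lambda>y. b x y)" and l2: "linear (\<lambda>x. b x y)" for x y
    by (auto simp: continuous_bilinear_form_def linear_functional_whole_space)
  have "isCont (\<lambda>(x, y). b x y) (0, 0)"
    using b by (simp add: continuous_bilinear_form_def continuous_on_eq_continuous_at)
  moreover have "b 0 0 = 0" using linear_0[OF l1] .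
  ultimately obtain d where d: "d > 0" "\<And>x y. norm (x, y) < d \<Longrightarrow> \<bar>b x y\<bar> < 1"
    unfolding continuous_at_eps_delta by (auto simp: dist_norm dest!: spec[of _ 1])
  have bound: "\<bar>b x y\<bar> \<le> norm x * norm y * (16 / d^2)" for x y
  proof (cases "x = 0 \<or> y = 0")
    case False
    have "norm ((d / 4 / norm x) *\<^sub>R x, (d / 4 / norm y) *\<^sub>R y)
        \<le> norm ((d / 4 / norm x) *\<^sub>R x) + norm ((d / 4 / norm y) *\<^sub>R y)"
      by (rule norm_Pair_le)
    also have "\<dots> < d" using False d(1) by simp
    finally have "\<bar>b ((d / 4 / norm x) *\<^sub>R x) ((d / 4 / norm y) *\<^sub>R y)\<bar> < 1"
      by (rule d(2))
    then have "d^2 * \<bar>b x y\<bar> < 16 * (norm x * norm y)"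
      using d(1) False
      by (simp add: linear_scale[OF l1] linear_scale[OF l2] abs_mult field_simps power2_eq_square)
    then show ?thesis using d(1) by (simp add: field_simps)
  qed (use linear_0[OF l1] linear_0[OF l2] in auto)
  show "bounded_bilinear b"
    using bound
    by (auto intro!: bounded_bilinear.intro exI[of _ "16 / d^2"]
        simp: linear_add[OF l1] linear_add[OF l2] linear_scale[OF l1] linear_scale[OF l2])
next
  assume "bounded_bilinear b"
  then interpret bounded_bilinear b .
  have "continuous_on UNIV (\<lambda>(x, y). b x y)"
    by (auto simp: case_prod_unfold intro!: continuous_on continuous_intros)
  then show "continuous_bilinear_form whole_space b"
    by (simp add: continuous_bilinear_form_def linear_functional_whole_space
        bounded_linear.linear bounded_linear_left bounded_linear_right)
qed

lemma convex_fun_whole_space: "convex_fun whole_space f \<longleftrightarrow> convex_on UNIV f"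
proof
  assume "convex_fun whole_space f"
  then show "convex_on UNIV f"
    by (intro convex_onI) (auto simp: convex_fun_def)
next
  assume "convex_on UNIV f"
  then show "convex_fun whole_space f"
    by (auto simp: convex_fun_def dest: convex_onD)
qed

lemma has_frechet_derivative_whole_space:
  fixes f :: "'a::real_normed_vector \<Rightarrow> real"
  shows "has_frechet_derivative whole_space f \<phi> x \<longleftrightarrow> (f has_derivative \<phi>) (at x)"
proof -
  have "((\<lambda>h. (f (x + h) - f x - \<phi> h) / norm h) \<longlongrightarrow> 0) (at 0) \<longleftrightarrow>
      ((\<lambda>h. norm (f (x + h) - f x - \<phi> h) / norm h) \<longlongrightarrow> 0) (at 0)"
    by (subst tendsto_rabs_zero_iff[symmetric]) simp
  moreover have "atin euclidean (0::'a) = at 0"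
    by (simp add: atin_def at_within_def nhdsin_def nhds_def Compl_eq_Diff_UNIV)
  ultimately show ?thesis
    using continuous_linear_functional_whole_space[of \<phi>]
    by (auto simp: has_frechet_derivative_def has_derivative_at)
qed

lemma C11_fun_whole_space:
  fixes f :: "'a::real_normed_vector \<Rightarrow> real"
  shows "C11_fun whole_space f \<longleftrightarrow>
    (\<exists>f' :: 'a \<Rightarrow> 'a \<Rightarrow>\<^sub>L real. (\<forall>x. (f has_derivative blinfun_apply (f' x)) (at x)) \<and>
      (\<exists>L. L-lipschitz_on UNIV f'))"
proof
  assume "C11_fun whole_space f"
  then obtain f' L where f': "\<And>x. (f has_derivative f' x) (at x)"
    and L: "\<And>x y. dual_norm whole_space (\<lambda>h. f' x h - f' y h) \<le> L * dist x y"
    by (auto simp: C11_fun_def has_frechet_derivative_whole_space)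
  define F where "F x = Blinfun (f' x)" for x
  have F: "blinfun_apply (F x) = f' x" for x
    unfolding F_def using f' by (intro bounded_linear_Blinfun_apply) (rule has_derivative_bounded_linear)
  have "dist (F x) (F y) = dual_norm whole_space (\<lambda>h. f' x h - f' y h)" for x y
    by (simp add: dist_norm norm_blinfun.rep_eq onorm_def dual_norm_def minus_blinfun.rep_eq F)
  with L have "dist (F x) (F y) \<le> L * dist x y" for x y
    by simp
  then have "dist (F x) (F y) \<le> \<bar>L\<bar> * dist x y" for x y
    by (rule order_trans) (intro mult_right_mono abs_ge_self zero_le_dist)
  then have "\<bar>L\<bar>-lipschitz_on UNIV F"
    by (intro lipschitz_onI) auto
  then show "\<exists>f' :: 'a \<Rightarrow> 'a \<Rightarrow>\<^sub>L real. (\<forall>x. (f has_derivative blinfun_apply (f' x)) (at x)) \<and>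
      (\<exists>L. L-lipschitz_on UNIV f')"
    using f' F by (intro exI[of _ F]) auto
next
  assume "\<exists>f' :: 'a \<Rightarrow> 'a \<Rightarrow>\<^sub>L real. (\<forall>x. (f has_derivative blinfun_apply (f' x)) (at x)) \<and>
      (\<exists>L. L-lipschitz_on UNIV f')"
  then obtain F :: "'a \<Rightarrow> 'a \<Rightarrow>\<^sub>L real" and L
    where F: "\<And>x. (f has_derivative blinfun_apply (F x)) (at x)" and L: "L-lipschitz_on UNIV F"
    by auto
  have "dist (F x) (F y) = dual_norm whole_space (\<lambda>h. F x h - F y h)" for x y
    by (simp add: dist_norm norm_blinfun.rep_eq onorm_def dual_norm_def minus_blinfun.rep_eq)
  then show "C11_fun whole_space f"
    using F lipschitz_onD[OF L]
    by (auto simp: C11_fun_def has_frechet_derivative_whole_space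
        intro!: exI[of _ "\<lambda>x. blinfun_apply (F x)"] exI[of _ L])
qed


text \<open>The quotient by a closed subspace is a normed space.\<close>

lemma quotient_space_simps:
  "carr (quotient_space E) = range (\<lambda>x. x +o E)"
  "vadd (quotient_space E) = (\<lambda>A B. A + B)"
  "vzero (quotient_space E) = E"
  "vscale (quotient_space E) = (\<lambda>c A. (*\<^sub>R) c ` A + E)"
  "vnorm (quotient_space E) = (\<lambda>A. INF a\<in>A. norm a)"
  by (simp_all add: quotient_space_def)

lemma coset_eq_iff:
  assumes "subspace E"
  shows "x +o E = y +o E \<longleftrightarrow> x - y \<in> E"
proof
  assume "x +o E = y +o E"
  moreover have "x \<in> x +o E" using subspace_0[OF assms] by (auto simp: elt_set_plus_def)
  ultimately show "x - y \<in> E" by (auto simp: elt_set_plus_def)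
next
  assume *: "x - y \<in> E"
  show "x +o E = y +o E"
  proof (intro equalityI subsetI)
    fix z assume "z \<in> x +o E"
    then obtain e where "e \<in> E" "z = x + e" by (auto simp: elt_set_plus_def)
    then show "z \<in> y +o E"
      using subspace_add[OF assms * \<open>e \<in> E\<close>]
      by (auto simp: elt_set_plus_def intro!: bexI[of _ "x - y + e"])
  next
    fix z assume "z \<in> y +o E"
    then obtain e where "e \<in> E" "z = y + e" by (auto simp: elt_set_plus_def)
    then show "z \<in> x +o E"
      using subspace_diff[OF assms \<open>e \<in> E\<close> *]
      by (auto simp: elt_set_plus_def intro!: bexI[of _ "e - (x - y)"])
  qed
qed

lemma coset_add:
  assumes "subspace E"
  shows "(x +o E) + (y +o E) = (x + y) +o E"
proof (intro equalityI subsetI)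
  fix z assume "z \<in> (x +o E) + (y +o E)"
  then obtain d e where "d \<in> E" "e \<in> E" "z = (x + d) + (y + e)"
    by (auto simp: elt_set_plus_def set_plus_def)
  then show "z \<in> (x + y) +o E"
    using subspace_add[OF assms, of d e]
    by (auto simp: elt_set_plus_def algebra_simps intro!: bexI[of _ "d + e"])
next
  fix z assume "z \<in> (x + y) +o E"
  then obtain e where "e \<in> E" "z = (x + 0) + (y + e)"
    by (auto simp: elt_set_plus_def algebra_simps)
  then show "z \<in> (x +o E) + (y +o E)"
    using subspace_0[OF assms] unfolding elt_set_plus_def set_plus_def by blast
qed

lemma coset_scale:
  assumes "subspace E"
  shows "(*\<^sub>R) c ` (x +o E) + E = (c *\<^sub>R x) +o E"
proof (intro equalityI subsetI)
  fix z assume "z \<in> (*\<^sub>R) c ` (x +o E) + E"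
  then obtain d e where "d \<in> E" "e \<in> E" "z = c *\<^sub>R (x + d) + e"
    by (auto simp: elt_set_plus_def set_plus_def)
  then show "z \<in> (c *\<^sub>R x) +o E"
    using subspace_add[OF assms subspace_scale[OF assms], of d e c]
    by (auto simp: elt_set_plus_def algebra_simps intro!: bexI[of _ "c *\<^sub>R d + e"])
next
  fix z assume "z \<in> (c *\<^sub>R x) +o E"
  then obtain e where "e \<in> E" "z = c *\<^sub>R (x + 0) + e"
    by (auto simp: elt_set_plus_def)
  then show "z \<in> (*\<^sub>R) c ` (x +o E) + E"
    using subspace_0[OF assms] unfolding elt_set_plus_def set_plus_def by blast
qed

lemma coset_norm:
  assumes "subspace E"
  shows "(INF a\<in>x +o E. norm a) = infdist x E"
proof -
  have "norm ` (x +o E) = dist x ` E"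
  proof (intro equalityI subsetI)
    fix r assume "r \<in> norm ` (x +o E)"
    then obtain e where "e \<in> E" "r = norm (x + e)" by (auto simp: elt_set_plus_def)
    then show "r \<in> dist x ` E"
      using subspace_neg[OF assms] by (auto simp: dist_norm intro!: image_eqI[of _ _ "- e"])
  next
    fix r assume "r \<in> dist x ` E"
    then obtain e where "e \<in> E" "r = norm (x - e)" by (auto simp: dist_norm)
    then show "r \<in> norm ` (x +o E)"
      using subspace_neg[OF assms]
      by (auto simp: elt_set_plus_def intro!: image_eqI[of _ _ "x - e"] bexI[of _ "- e"])
  qed
  moreover have "E \<noteq> {}" using subspace_0[OF assms] by auto
  ultimately show ?thesis by (simp add: infdist_def)
qed

lemma normed_space_on_quotient_space:
  fixes E :: "'a::real_normed_vector set"
  assumes E: "subspace E" and cl: "closed E"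
  shows "normed_space_on (quotient_space E)"
proof -
  have ne: "E \<noteq> {}" using subspace_0[OF E] by auto
  have zero: "E = 0 +o E" by (simp add: elt_set_plus_def)
  have zero': "x +o E = E \<longleftrightarrow> x \<in> E" for x
    using coset_eq_iff[OF E, of x 0] by (simp flip: zero)
  have le: "infdist (c *\<^sub>R x) E \<le> \<bar>c\<bar> * infdist x E" if "c \<noteq> 0" for c x
  proof -
    have "infdist (c *\<^sub>R x) E / \<bar>c\<bar> \<le> dist x e" if "e \<in> E" for e
    proof -
      have "infdist (c *\<^sub>R x) E \<le> dist (c *\<^sub>R x) (c *\<^sub>R e)"
        by (intro infdist_le subspace_scale E that)
      also have "\<dots> = \<bar>c\<bar> * dist x e"
        by (simp add: dist_norm flip: scaleR_diff_right)
      finally show ?thesis using \<open>c \<noteq> 0\<close> by (simp add: field_simps)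
    qed
    then have "infdist (c *\<^sub>R x) E / \<bar>c\<bar> \<le> infdist x E"
      using ne by (auto simp: infdist_def intro!: cINF_greatest)
    then show ?thesis using \<open>c \<noteq> 0\<close> by (simp add: field_simps)
  qed
  have scale: "infdist (c *\<^sub>R x) E = \<bar>c\<bar> * infdist x E" for c x
  proof (cases "c = 0")
    case True
    then show ?thesis using subspace_0[OF E] by simp
  next
    case False
    have "infdist x E \<le> \<bar>inverse c\<bar> * infdist (c *\<^sub>R x) E"
      using le[of "inverse c" "c *\<^sub>R x"] False by simp
    then have "\<bar>c\<bar> * infdist x E \<le> infdist (c *\<^sub>R x) E"
      using False by (simp add: field_simps abs_inverse)
    then show ?thesis using le[OF False, of x] by simp
  qed
  have tri: "infdist (x + y) E \<le> infdist x E + infdist y E" for x y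
  proof -
    have "infdist (x + y) E - dist x d \<le> infdist y E" if "d \<in> E" for d
    proof -
      have "infdist (x + y) E - dist x d \<le> dist y e" if "e \<in> E" for e
      proof -
        have "infdist (x + y) E \<le> dist (x + y) (d + e)"
          by (intro infdist_le subspace_add E \<open>d \<in> E\<close> that)
        also have "\<dots> \<le> dist x d + dist y e" by (rule dist_triangle_add)
        finally show ?thesis by simp
      qed
      then show ?thesis using ne by (auto simp: infdist_def[of y] intro!: cINF_greatest)
    qed
    then have "infdist (x + y) E - infdist y E \<le> dist x d" if "d \<in> E" for d
      using that by (simp add: algebra_simps)
    then have "infdist (x + y) E - infdist y E \<le> infdist x E"
      using ne by (auto simp: infdist_def[of x] intro!: cINF_greatest)
    then show ?thesis by simp
  qed
  have norm_zero: "infdist x E = 0 \<longleftrightarrow> x \<in> E" for x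
    using in_closed_iff_infdist_zero[OF cl ne] by auto
  let ?V = "quotient_space E"
  have carr: "carr ?V = range (\<lambda>x. x +o E)"
    and vadd: "vadd ?V (x +o E) (y +o E) = (x + y) +o E"
    and vscale: "vscale ?V c (x +o E) = (c *\<^sub>R x) +o E"
    and vnorm: "vnorm ?V (x +o E) = infdist x E"
    and vzero: "vzero ?V = 0 +o E" for x y c
    using zero by (simp_all add: quotient_space_simps coset_add[OF E] coset_scale[OF E] coset_norm[OF E])
  have eq_zero: "x +o E = 0 +o E \<longleftrightarrow> x \<in> E" for x
    using coset_eq_iff[OF E, of x 0] by simp
  have mem: "x +o E \<in> range (\<lambda>x. x +o E)" for x
    by blast
  note simps = vadd vscale vnorm vzero
  show ?thesis
  proof (unfold_locales, unfold carr)
    show "vzero ?V \<in> range (\<lambda>x. x +o E)" unfolding vzero by blast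
  qed (elim rangeE; simp only: simps eq_zero norm_zero scale tri infdist_nonneg mem
      scaleR_add_right scaleR_add_left scaleR_scaleR scaleR_one add_0 add_0_right ac_simps
      scaleR_minus1_left right_minus subspace_0[OF E])+
qed

end

theory Submission
  imports Defs
begin

text \<open>
  Let \<open>\<pi>: X \<rightarrow> X/E\<close> be the quotient map.  A continuous quadratic form or a \<open>C\<^sup>1\<^sup>,\<^sup>1\<close> function \<open>f\<close> on
  \<open>X/E\<close> pulls back along \<open>\<pi>\<close> to one of the same kind on \<open>X\<close>, so it suffices to push delta-convexity
  down: if \<open>f \<circ> \<pi> = g - h\<close> with \<open>g\<close> and \<open>h\<close> continuous and convex on \<open>X\<close>, then \<open>f\<close> is delta-convex
  (\<open>delta_convex_quotient_if_pullback\<close>).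

  The idea is to take infima over cosets, \<open>G(A) = inf\<^sub>A g\<close> and \<open>H(A) = inf\<^sub>A h\<close>.  On a coset \<open>A\<close> the
  functions \<open>g\<close> and \<open>h\<close> differ by the constant \<open>f(A)\<close>, so \<open>f = G - H\<close> as soon as the infima are
  finite, and partial infima of convex functions are convex (\<open>convex_fun_coset_inf\<close>).

  Finiteness is arranged beforehand: a continuous convex function decreases at most linearly
  (\<open>convex_plus_norm_bounded_below\<close>), so for large \<open>K\<close> both \<open>g + K\<parallel>\<cdot>\<parallel>\<close> and \<open>h + K\<parallel>\<cdot>\<parallel>\<close> are bounded below,
  while their difference is still \<open>f \<circ> \<pi>\<close>; they replace \<open>g\<close> and \<open>h\<close>.  Then \<open>G \<circ> \<pi>\<close> lies between a
  constant and the continuous function \<open>g\<close>, so it is locally bounded, and a locally bounded convex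
  function is continuous.  As \<open>\<pi>\<close> is a topological quotient map (\<open>quotient_map_coset\<close>), \<open>G\<close> is
  continuous, and so is \<open>H\<close>.
\<close>


section \<open>Continuous convex functions on a normed space\<close>

text \<open>
  If \<open>g\<close> varies by less than 1 on the ball of radius \<open>d\<close> at 0, convexity on the line through \<open>x\<close>
  and 0, continued to \<open>- (d / \<parallel>x\<parallel>) x\<close>, shows that \<open>g\<close> has slope at least \<open>- 1 / d\<close> from 0 to \<open>x\<close>.
\<close>

lemma convex_plus_norm_bounded_below:
  fixes g :: "'a::real_normed_vector \<Rightarrow> real"
  assumes convex: "convex_on UNIV g" and cont: "continuous_on UNIV g"
  obtains K m where "K \<ge> 0" "\<And>x. m \<le> g x + K * norm x"
proof -
  have "isCont g 0"
    using cont by (simp add: continuous_on_eq_continuous_at)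
  then obtain r where "r > 0" and r: "\<And>x. norm x < r \<Longrightarrow> \<bar>g x - g 0\<bar> < 1"
    unfolding continuous_at_eps_delta by (auto simp: dist_norm dest!: spec[of _ 1])
  define d where "d = r / 2"
  have "d > 0" using \<open>r > 0\<close> by (simp add: d_def)
  have d: "\<bar>g x - g 0\<bar> < 1" if "norm x \<le> d" for x
    using \<open>r > 0\<close> that by (intro r) (simp add: d_def)
  have "g 0 - 1 \<le> g x + 1 / d * norm x" for x
  proof (cases "norm x \<le> d")
    case True
    moreover have "0 \<le> 1 / d * norm x" using \<open>d > 0\<close> by simp
    ultimately show ?thesis using d[of x] by linarith
  next
    case False
    define t where "t = d / norm x"
    have "norm x > 0"
      using False \<open>d > 0\<close> by linarith
    then have t: "0 < t" and "norm (- t *\<^sub>R x) \<le> d"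
      using \<open>d > 0\<close> by (simp_all add: t_def)
    then have far: "g (- t *\<^sub>R x) < g 0 + 1"
      using d[of "- t *\<^sub>R x"] by linarith
    \<comment> \<open>the weight with which 0 lies between \<open>- t x\<close> and \<open>x\<close>\<close>
    define s where "s = t / (1 + t)"
    have s: "0 \<le> s" "s \<le> 1" "(1 + t) * s = t" "(1 + t) * (1 - s) = 1"
      using t by (simp_all add: s_def field_simps)
    have "(1 - s) * - t + s = 0"
      using t by (simp add: s_def field_simps)
    then have "(1 - s) *\<^sub>R (- t *\<^sub>R x) + s *\<^sub>R x = 0"
      by (metis scaleR_left_distrib scaleR_scaleR scaleR_zero_left)
    then have "g 0 \<le> (1 - s) * g (- t *\<^sub>R x) + s * g x"
      using convex_onD[OF convex s(1,2) UNIV_I UNIV_I, of "- t *\<^sub>R x" x]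
      by (simp only:)
    then have "(1 + t) * g 0 \<le> (1 + t) * ((1 - s) * g (- t *\<^sub>R x) + s * g x)"
      using t by (intro mult_left_mono) auto
    also have "\<dots> = ((1 + t) * (1 - s)) * g (- t *\<^sub>R x) + ((1 + t) * s) * g x"
      by (simp add: algebra_simps)
    also have "\<dots> < g 0 + 1 + t * g x"
      using far by (simp add: s)
    finally have "t * g 0 < 1 + t * g x"
      by (simp add: algebra_simps)
    then have "g 0 < 1 / t + g x"
      using t by (simp add: field_simps)
    then show ?thesis by (simp add: t_def)
  qed
  then show thesis
    using \<open>d > 0\<close> by (intro that[of "1 / d" "g 0 - 1"]) auto
qed

text \<open>
  Near each \<open>x\<close> the function \<open>g\<close> is at most \<open>g x + 1\<close>, so \<open>D\<close> is bounded on a ball around \<open>x\<close>,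
  which is enough for continuity of a convex function at \<open>x\<close>.
\<close>

lemma convex_between_continuous_imp_continuous:
  fixes D :: "'a::real_normed_vector \<Rightarrow> real"
  assumes convex: "convex_on UNIV D" and upper: "\<And>x. D x \<le> g x" and lower: "\<And>x. m \<le> D x"
    and cont: "continuous_on UNIV g"
  shows "continuous_on UNIV D"
proof -
  have "isCont D x" for x
  proof -
    have "isCont g x"
      using cont by (simp add: continuous_on_eq_continuous_at)
    then obtain d where "d > 0" and d: "\<And>y. norm (y - x) < d \<Longrightarrow> \<bar>g y - g x\<bar> < 1"
      unfolding continuous_at_eps_delta by (auto simp: dist_norm dest!: spec[of _ 1])
    have "\<bar>D y\<bar> \<le> \<bar>m\<bar> + \<bar>g x\<bar> + 1" if "y \<in> ball x d" for y
    proof -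
      have "\<bar>g y - g x\<bar> < 1"
        using that by (intro d) (simp add: dist_norm norm_minus_commute)
      then show ?thesis using upper[of y] lower[of y] by linarith
    qed
    then have "continuous_on (ball x d) D"
      using convex_on_subset[OF convex]
      by (intro convex_on_bounded_continuous[where b = "\<bar>m\<bar> + \<bar>g x\<bar> + 1"]) auto
    then show ?thesis
      using \<open>d > 0\<close> by (simp add: continuous_on_eq_continuous_at)
  qed
  then show ?thesis by (simp add: continuous_on_eq_continuous_at)
qed


section \<open>The quotient map\<close>

context
  fixes E :: "'a::real_normed_vector set"
  assumes subspace: "subspace E" and closed: "closed E"
begin

abbreviation "Q \<equiv> quotient_space E"
abbreviation "\<pi> x \<equiv> x +o E"

interpretation Q: Metric_space "carr Q" "vdist Q"
  using normed_space_on_quotient_space[OF subspace closed] by (rule normed_space_on.Metric_space_vdist)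

lemma zero_coset: "\<pi> 0 = E"
  by (simp add: elt_set_plus_def)

lemma self_mem_coset: "x \<in> \<pi> x"
  using subspace_0[OF subspace] by (auto simp: elt_set_plus_def)

lemma coset_eq_of_mem: "a \<in> \<pi> x \<Longrightarrow> \<pi> a = \<pi> x"
  using coset_eq_iff[OF subspace] by (auto simp: elt_set_plus_def)

lemma quotient_ops:
  "carr Q = range \<pi>" "\<pi> x \<in> carr Q" "vzero Q = \<pi> 0" "vadd Q (\<pi> x) (\<pi> y) = \<pi> (x + y)"
  "vscale Q c (\<pi> x) = \<pi> (c *\<^sub>R x)" "vnorm Q (\<pi> x) = infdist x E"
  by (auto simp: quotient_space_simps coset_add[OF subspace] coset_scale[OF subspace]
      coset_norm[OF subspace] zero_coset)

lemma vdist_quotient: "vdist Q (\<pi> x) (\<pi> y) = infdist (x - y) E"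
  by (simp add: vdist_def quotient_ops)

lemma infdist_le_norm: "infdist x E \<le> norm x"
  using infdist_le[OF subspace_0[OF subspace], of x] by simp

lemma small_representative:
  assumes "infdist (x - y) E < r"
  obtains a where "\<pi> a = \<pi> x" "norm (a - y) < r"
proof -
  have "(INF e\<in>E. dist (x - y) e) < r"
    using assms subspace_0[OF subspace] by (auto simp: infdist_def split: if_splits)
  then obtain e where "e \<in> E" "dist (x - y) e < r"
    using subspace_0[OF subspace] by (subst (asm) cINF_less_iff) auto
  then show thesis
    by (intro that[of "x - e"])
      (simp_all add: coset_eq_iff[OF subspace] subspace_neg[OF subspace] dist_norm
        diff_diff_eq add.commute)
qed

text \<open>
  \<open>\<pi>\<close> is open as well as continuous: by the choice of small representatives, it maps the open ball
  of radius \<open>r\<close> at \<open>x\<close> onto the open ball of radius \<open>r\<close> at \<open>\<pi> x\<close>.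
\<close>

lemma quotient_map_coset: "quotient_map euclidean (vtopology Q) \<pi>"
proof (rule continuous_open_imp_quotient_map)
  show "continuous_map euclidean (vtopology Q) \<pi>"
    unfolding vtopology_def Q.continuous_map_to_metric
  proof (intro ballI allI impI)
    fix x :: 'a and r :: real assume "r > 0"
    have "\<pi> y \<in> Q.mball (\<pi> x) r" if "y \<in> ball x r" for y
      using that infdist_le_norm[of "x - y"] by (simp add: quotient_ops(2) vdist_quotient dist_norm)
    then show "\<exists>U. openin euclidean U \<and> x \<in> U \<and> (\<forall>y\<in>U. \<pi> y \<in> Q.mball (\<pi> x) r)"
      using \<open>r > 0\<close> by (intro exI[of _ "ball x r"]) auto
  qed
  show "open_map euclidean (vtopology Q) \<pi>"
    unfolding open_map_def vtopology_def Q.openin_mtopology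
  proof (intro allI impI conjI)
    fix U :: "'a set" and A assume "openin euclidean U"
    then have "open U" by simp
    show "\<pi> ` U \<subseteq> carr Q" by (auto simp: quotient_ops)
    assume "A \<in> \<pi> ` U"
    then obtain x where x: "x \<in> U" "A = \<pi> x" by auto
    obtain r where "r > 0" and r: "ball x r \<subseteq> U"
      using \<open>open U\<close> x(1) by (meson openE)
    have "Q.mball A r \<subseteq> \<pi> ` U"
    proof
      fix B assume "B \<in> Q.mball A r"
      then obtain y where y: "B = \<pi> y" "vdist Q A (\<pi> y) < r"
        unfolding Q.in_mball by (auto simp: quotient_ops(1))
      then have "infdist (y - x) E < r"
        using Q.commute[of "\<pi> x" "\<pi> y"] by (simp add: x(2) vdist_quotient)
      then obtain a where "\<pi> a = \<pi> y" "norm (a - x) < r"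
        using small_representative by blast
      moreover then have "a \<in> U"
        using r by (auto simp: dist_norm norm_minus_commute)
      ultimately show "B \<in> \<pi> ` U" by (metis imageI y(1))
    qed
    then show "\<exists>r>0. Q.mball A r \<subseteq> \<pi> ` U" using \<open>r > 0\<close> by blast
  qed
  show "\<pi> ` topspace euclidean = topspace (vtopology Q)"
    unfolding vtopology_def Q.topspace_mtopology by (simp add: quotient_ops(1))
qed

lemma continuous_fun_quotient_iff: "continuous_fun Q f \<longleftrightarrow> continuous_on UNIV (f \<circ> \<pi>)"
  using continuous_compose_quotient_map_eq[OF quotient_map_coset, of euclideanreal f]
  by (simp add: continuous_fun_def)

lemma convex_on_pullback:
  assumes "convex_fun Q f"
  shows "convex_on UNIV (f \<circ> \<pi>)"
  using assms
  by (auto simp: convex_fun_def quotient_ops intro!: convex_onI)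

lemma linear_functional_pullback:
  assumes "linear_functional Q \<phi>"
  shows "linear_functional whole_space (\<phi> \<circ> \<pi>)"
  using assms by (auto simp: linear_functional_def quotient_ops)

lemma bounded_linear_pullback:
  assumes "linear_functional Q \<phi>" "continuous_fun Q \<phi>"
  shows "bounded_linear (\<phi> \<circ> \<pi>)"
  using assms linear_functional_pullback
  by (simp flip: continuous_linear_functional_whole_space
      add: continuous_fun_whole_space continuous_fun_quotient_iff)


section \<open>Pushing delta-convexity down to the quotient\<close>

text \<open>
  Convex combinations of a point of \<open>A\<close> and a point of \<open>B\<close> lie in the corresponding combination of
  the cosets \<open>A\<close> and \<open>B\<close>; apply convexity of \<open>g\<close> to almost minimal points.
\<close>

lemma convex_fun_coset_inf:
  assumes convex: "convex_on UNIV g" and lower: "\<And>x. m \<le> g x"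
  shows "convex_fun Q (\<lambda>A. INF a\<in>A. g a)"
  unfolding convex_fun_def
proof (intro allI ballI impI)
  have bdd: "bdd_below (g ` A)" for A
    using lower by (auto intro!: bdd_belowI2)
  fix t :: real and A B assume "A \<in> carr Q" "B \<in> carr Q" and "0 \<le> t \<and> t \<le> 1"
  then obtain x y where A: "A = \<pi> x" and B: "B = \<pi> y" and t: "0 \<le> t" "t \<le> 1"
    by (auto simp: quotient_ops)
  show "(INF a\<in>vadd Q (vscale Q (1 - t) A) (vscale Q t B). g a)
      \<le> (1 - t) * (INF a\<in>A. g a) + t * (INF a\<in>B. g a)" (is "?l \<le> (1 - t) * ?a + t * ?b")
  proof (rule field_le_epsilon)
    fix e :: real assume "e > 0"
    have "A \<noteq> {}" "B \<noteq> {}" using self_mem_coset A B by blast+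
    then have "\<exists>a\<in>A. g a < ?a + e" "\<exists>b\<in>B. g b < ?b + e"
      using \<open>e > 0\<close> by (simp_all flip: cINF_less_iff add: bdd)
    then obtain a b where a: "a \<in> A" "g a < ?a + e" and b: "b \<in> B" "g b < ?b + e"
      by blast
    have "A = \<pi> a" "B = \<pi> b"
      using coset_eq_of_mem a(1) b(1) by (simp_all add: A B)
    then have "vadd Q (vscale Q (1 - t) A) (vscale Q t B) = \<pi> ((1 - t) *\<^sub>R a + t *\<^sub>R b)"
      by (simp only: quotient_ops)
    then have "?l \<le> g ((1 - t) *\<^sub>R a + t *\<^sub>R b)"
      by (auto intro!: cINF_lower bdd self_mem_coset)
    also have "\<dots> \<le> (1 - t) * g a + t * g b"
      using convex_onD[OF convex t] by simp
    also have "\<dots> \<le> (1 - t) * (?a + e) + t * (?b + e)"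
      using t a(2) b(2) by (intro add_mono mult_left_mono) auto
    also have "\<dots> = (1 - t) * ?a + t * ?b + e"
      by (simp add: algebra_simps)
    finally show "?l \<le> (1 - t) * ?a + t * ?b + e" .
  qed
qed

lemma continuous_fun_coset_inf:
  assumes convex: "convex_on UNIV g" and cont: "continuous_on UNIV g" and lower: "\<And>x. m \<le> g x"
  shows "continuous_fun Q (\<lambda>A. INF a\<in>A. g a)"
  unfolding continuous_fun_quotient_iff
proof (rule convex_between_continuous_imp_continuous[OF _ _ _ cont])
  have bdd: "bdd_below (g ` A)" for A
    using lower by (auto intro!: bdd_belowI2)
  show "convex_on UNIV ((\<lambda>A. INF a\<in>A. g a) \<circ> \<pi>)"
    by (intro convex_on_pullback convex_fun_coset_inf[OF convex lower])
  show "((\<lambda>A. INF a\<in>A. g a) \<circ> \<pi>) x \<le> g x" for x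
    by (auto intro!: cINF_lower bdd self_mem_coset)
  show "m \<le> ((\<lambda>A. INF a\<in>A. g a) \<circ> \<pi>) x" for x
    using self_mem_coset[of x] by (auto intro!: cINF_greatest lower)
qed

lemma delta_convex_quotient_if_pullback:
  assumes "delta_convex whole_space (f \<circ> \<pi>)"
  shows "delta_convex Q f"
proof -
  obtain g h where g: "convex_on UNIV g" "continuous_on UNIV g"
    and h: "convex_on UNIV h" "continuous_on UNIV h" and f: "\<And>x. f (\<pi> x) = g x - h x"
    using assms by (auto simp: delta_convex_def continuous_fun_whole_space convex_fun_whole_space)
  obtain K m where K: "K \<ge> 0" "\<And>x. m \<le> g x + K * norm x"
    using convex_plus_norm_bounded_below[OF g] by blast
  obtain L n where L: "L \<ge> 0" "\<And>x. n \<le> h x + L * norm x"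
    using convex_plus_norm_bounded_below[OF h] by blast
  \<comment> \<open>the same function is added to \<open>g\<close> and \<open>h\<close>, so that it cancels in the difference\<close>
  define p :: "'a \<Rightarrow> real" where "p x = (K + L) * norm x" for x
  define g' where "g' x = g x + p x" for x
  define h' where "h' x = h x + p x" for x
  have "convex_on UNIV (norm :: 'a \<Rightarrow> real)"
    using convex_on_dist[of UNIV "0 :: 'a"] by simp
  then have p: "convex_on UNIV p" "continuous_on UNIV p"
    using K(1) L(1) unfolding p_def by (auto intro!: convex_on_cmul continuous_intros)
  have g': "convex_on UNIV g'" "continuous_on UNIV g'" and h': "convex_on UNIV h'" "continuous_on UNIV h'"
    using g h p unfolding g'_def h'_def by (auto intro!: convex_on_add continuous_intros)
  have lg: "m \<le> g' x" for x
    using K(2)[of x] mult_nonneg_nonneg[OF L(1) norm_ge_zero[of x]]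
    by (simp add: g'_def p_def algebra_simps)
  have lh: "n \<le> h' x" for x
    using L(2)[of x] mult_nonneg_nonneg[OF K(1) norm_ge_zero[of x]]
    by (simp add: h'_def p_def algebra_simps)
  have "f A = (INF a\<in>A. g' a) - (INF a\<in>A. h' a)" if "A \<in> carr Q" for A
  proof -
    have eq: "g' a = f A + h' a" if "a \<in> A" for a
      using \<open>A \<in> carr Q\<close> that f[of a] coset_eq_of_mem[of a]
      by (auto simp: quotient_ops(1) g'_def h'_def)
    have ne: "A \<noteq> {}"
      using that self_mem_coset by (auto simp: quotient_ops(1))
    have "(INF a\<in>A. g' a) - f A \<le> h' a" if "a \<in> A" for a
      using cINF_lower[OF bdd_belowI2[where f = g', OF lg] that] eq[OF that] by simp
    moreover have "f A + (INF a\<in>A. h' a) \<le> g' a" if "a \<in> A" for a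
      using cINF_lower[OF bdd_belowI2[where f = h', OF lh] that] eq[OF that] by simp
    ultimately have "(INF a\<in>A. g' a) - f A \<le> (INF a\<in>A. h' a)"
      "f A + (INF a\<in>A. h' a) \<le> (INF a\<in>A. g' a)"
      by (auto intro!: cINF_greatest[OF ne])
    then show ?thesis by simp
  qed
  then show ?thesis
    unfolding delta_convex_def
    using convex_fun_coset_inf[OF g'(1) lg] continuous_fun_coset_inf[OF g' lg]
      convex_fun_coset_inf[OF h'(1) lh] continuous_fun_coset_inf[OF h' lh] by blast
qed


section \<open>Pulling forms and smooth functions back\<close>

lemma continuous_quadratic_form_pullback:
  assumes "continuous_quadratic_form Q q"
  shows "continuous_quadratic_form whole_space (q \<circ> \<pi>)"
proof -
  obtain b where b: "continuous_bilinear_form Q b" and q: "\<And>A. A \<in> carr Q \<Longrightarrow> q A = b A A"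
    using assms by (auto simp: continuous_quadratic_form_def)
  have "continuous_map (prod_topology euclidean euclidean) (prod_topology (vtopology Q) (vtopology Q))
      (\<lambda>(x, y). (\<pi> x, \<pi> y))"
    using quotient_imp_continuous_map[OF quotient_map_coset] by (subst continuous_map_prod_top) simp
  then have "continuous_map (prod_topology euclidean euclidean) euclideanreal
      ((\<lambda>(A, B). b A B) \<circ> (\<lambda>(x, y). (\<pi> x, \<pi> y)))"
    using b continuous_map_compose unfolding continuous_bilinear_form_def by blast
  then have "continuous_bilinear_form whole_space (\<lambda>x y. b (\<pi> x) (\<pi> y))"
    using b by (auto simp: continuous_bilinear_form_def linear_functional_def quotient_ops
        case_prod_unfold o_def)
  then show ?thesis
    using q by (auto simp: continuous_quadratic_form_def quotient_ops)
qed

text \<open>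
  Since \<open>\<pi>\<close> does not increase norms, the remainder at \<open>\<pi> h\<close> is small compared with \<open>\<parallel>h\<parallel>\<close> as well;
  for \<open>h \<in> E\<close>, where the difference quotient on \<open>X/E\<close> says nothing, the remainder is 0.
\<close>

lemma has_frechet_derivative_pullback:
  assumes "has_frechet_derivative Q f \<phi> (\<pi> x)"
  shows "has_frechet_derivative whole_space (f \<circ> \<pi>) (\<phi> \<circ> \<pi>) x"
  unfolding has_frechet_derivative_whole_space has_derivative_at_alt
proof (intro conjI allI impI)
  have lin: "linear_functional Q \<phi>" and "continuous_fun Q \<phi>"
    and lim: "((\<lambda>h. (f (vadd Q (\<pi> x) h) - f (\<pi> x) - \<phi> h) / vnorm Q h) \<longlongrightarrow> 0)
      (atin Q.mtopology (\<pi> 0))"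
    using assms by (auto simp: has_frechet_derivative_def vtopology_def quotient_ops)
  then show bl: "bounded_linear (\<phi> \<circ> \<pi>)"
    by (intro bounded_linear_pullback)
  fix e :: real assume "e > 0"
  then obtain d where "d > 0" and d: "\<And>A. A \<in> carr Q \<Longrightarrow> 0 < vdist Q A (\<pi> 0) \<Longrightarrow>
      vdist Q A (\<pi> 0) < d \<Longrightarrow> \<bar>(f (vadd Q (\<pi> x) A) - f (\<pi> x) - \<phi> A) / vnorm Q A\<bar> < e"
    using tendstoD[OF lim \<open>e > 0\<close>] quotient_ops(2)[of 0]
    unfolding Q.eventually_atin_metric dist_real_def diff_0_right by blast
  have "norm (f (\<pi> y) - f (\<pi> x) - \<phi> (\<pi> (y - x))) \<le> e * norm (y - x)" if "norm (y - x) < d" for y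
  proof (cases "infdist (y - x) E = 0")
    case True
    then have "y - x \<in> E"
      using in_closed_iff_infdist_zero[OF closed] subspace_0[OF subspace] by blast
    then have "\<pi> y = \<pi> x" "\<pi> (y - x) = \<pi> 0"
      using coset_eq_iff[OF subspace, of y x] coset_eq_iff[OF subspace, of "y - x" 0] by simp_all
    then show ?thesis
      using linear_0[OF bounded_linear.linear[OF bl]] \<open>e > 0\<close> by simp
  next
    case False
    then have pos: "0 < infdist (y - x) E"
      using infdist_nonneg[of "y - x" E] by linarith
    have "\<bar>(f (\<pi> y) - f (\<pi> x) - \<phi> (\<pi> (y - x))) / infdist (y - x) E\<bar> < e"
      using d[of "\<pi> (y - x)"] vdist_quotient[of "y - x" 0] pos infdist_le_norm[of "y - x"] that
      by (simp add: quotient_ops)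
    then have "\<bar>f (\<pi> y) - f (\<pi> x) - \<phi> (\<pi> (y - x))\<bar> \<le> e * infdist (y - x) E"
      using pos by (simp add: abs_divide pos_divide_less_eq)
    also have "\<dots> \<le> e * norm (y - x)"
      using \<open>e > 0\<close> infdist_le_norm by (intro mult_left_mono) auto
    finally show ?thesis by simp
  qed
  then show "\<exists>d>0. \<forall>y. norm (y - x) < d \<longrightarrow>
      norm ((f \<circ> \<pi>) y - (f \<circ> \<pi>) x - (\<phi> \<circ> \<pi>) (y - x)) \<le> e * norm (y - x)"
    using \<open>d > 0\<close> by auto
qed

text \<open>
  The supremum defining the dual norm on \<open>X/E\<close> is finite: a bound \<open>\<bar>\<phi> (\<pi> x)\<bar> \<le> K \<parallel>x\<parallel>\<close> for all
  representatives \<open>x\<close> of a coset gives \<open>\<bar>\<phi> A\<bar> \<le> K \<parallel>A\<parallel>\<close> in the quotient norm.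
\<close>

lemma dual_norm_pullback_le:
  assumes "bounded_linear (\<phi> \<circ> \<pi>)"
  shows "dual_norm whole_space (\<phi> \<circ> \<pi>) \<le> dual_norm Q \<phi>"
proof -
  obtain K where "K > 0" and K: "\<And>x. \<bar>\<phi> (\<pi> x)\<bar> \<le> norm x * K"
    using bounded_linear.pos_bounded[OF assms] by auto
  have bound: "\<bar>\<phi> (\<pi> x)\<bar> \<le> K * infdist x E" for x
  proof (rule ccontr)
    assume "\<not> ?thesis"
    then have "infdist (x - 0) E < \<bar>\<phi> (\<pi> x)\<bar> / K"
      using \<open>K > 0\<close> by (simp add: field_simps)
    then obtain a where "\<pi> a = \<pi> x" "norm (a - 0) < \<bar>\<phi> (\<pi> x)\<bar> / K"
      by (rule small_representative)
    then show False using K[of a] \<open>K > 0\<close> by (simp add: field_simps)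
  qed
  have bdd: "bdd_above ((\<lambda>A. \<bar>\<phi> A\<bar> / vnorm Q A) ` carr Q)"
  proof (rule bdd_aboveI2)
    fix A assume "A \<in> carr Q"
    then obtain x where "A = \<pi> x" by (auto simp: quotient_ops)
    then show "\<bar>\<phi> A\<bar> / vnorm Q A \<le> K"
      using bound[of x] infdist_nonneg[of x E] \<open>K > 0\<close>
      by (cases "infdist x E = 0") (auto simp: quotient_ops divide_le_eq)
  qed
  have "\<bar>\<phi> (\<pi> x)\<bar> / norm x \<le> dual_norm Q \<phi>" for x
  proof -
    have "\<bar>\<phi> (\<pi> x)\<bar> / norm x \<le> \<bar>\<phi> (\<pi> x)\<bar> / infdist x E"
    proof (cases "infdist x E = 0")
      case True
      then show ?thesis using bound[of x] by simp
    next
      case False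
      then have "0 < infdist x E"
        using infdist_nonneg[of x E] by linarith
      then show ?thesis
        using infdist_le_norm[of x] by (intro divide_left_mono mult_pos_pos) auto
    qed
    also have "\<dots> = \<bar>\<phi> (\<pi> x)\<bar> / vnorm Q (\<pi> x)"
      by (simp add: quotient_ops)
    also have "\<dots> \<le> dual_norm Q \<phi>"
      unfolding dual_norm_def by (rule cSUP_upper[OF quotient_ops(2) bdd])
    finally show ?thesis .
  qed
  then show ?thesis
    unfolding dual_norm_def[of whole_space] by (auto intro!: cSUP_least)
qed

lemma C11_fun_pullback:
  assumes "C11_fun Q f"
  shows "C11_fun whole_space (f \<circ> \<pi>)"
proof -
  obtain f' L where f': "\<And>x. has_frechet_derivative Q f (f' (\<pi> x)) (\<pi> x)"
    and L: "\<And>x y. dual_norm Q (\<lambda>h. f' (\<pi> x) h - f' (\<pi> y) h) \<le> L * vdist Q (\<pi> x) (\<pi> y)"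
    using assms by (auto simp: C11_fun_def quotient_ops(1))
  have bl: "bounded_linear (f' (\<pi> x) \<circ> \<pi>)" for x
    using f'[of x] by (auto simp: has_frechet_derivative_def intro: bounded_linear_pullback)
  have "dual_norm whole_space (\<lambda>h. f' (\<pi> x) (\<pi> h) - f' (\<pi> y) (\<pi> h)) \<le> \<bar>L\<bar> * dist x y" for x y
  proof -
    have "dual_norm whole_space ((\<lambda>h. f' (\<pi> x) h - f' (\<pi> y) h) \<circ> \<pi>)
        \<le> dual_norm Q (\<lambda>h. f' (\<pi> x) h - f' (\<pi> y) h)"
      using bounded_linear_sub[OF bl[of x] bl[of y]]
      by (intro dual_norm_pullback_le) (simp add: o_def)
    also have "\<dots> \<le> L * infdist (x - y) E"
      using L by (simp add: vdist_quotient)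
    also have "\<dots> \<le> \<bar>L\<bar> * dist x y"
      using infdist_le_norm[of "x - y"] by (intro mult_mono) (auto simp: dist_norm infdist_nonneg)
    finally show ?thesis by (simp add: o_def)
  qed
  then show ?thesis
    using has_frechet_derivative_pullback[OF f']
    by (auto simp: C11_fun_def o_def intro!: exI[of _ "\<lambda>x h. f' (\<pi> x) (\<pi> h)"] exI[of _ "\<bar>L\<bar>"])
qed

end


section \<open>Inheritance by quotients\<close>

theorem lemma3p1:
  fixes E :: "'a::banach set"
  assumes "subspace E" and "closed E"
  shows "(property_dc (whole_space :: 'a nspace) \<longrightarrow> property_dc (quotient_space E)) \<and>
         (property_Cdc (whole_space :: 'a nspace) \<longrightarrow> property_Cdc (quotient_space E))"
  using delta_convex_quotient_if_pullback[OF assms] continuous_quadratic_form_pullback[OF assms]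
    C11_fun_pullback[OF assms]
  by (auto simp: property_dc_def property_Cdc_def)

end
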